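(* Let $\omega$ be a clustering state and $j\mapsto A_j\in\mathcal O$. (a) If $(A_j)$ is Cauchy with respect to $\|\cdot\|_{\mathcal H^*_\omega}$ with limit $A\in\mathcal H^*_\omega$, let $P$ be the (unique) right pseudolocal charge with $P(B)=\langle A,B\rangle^*_\omega$ for all $B\in\mathcal O$, and let $P^{(j)}$ be the right pseudolocal charge of the local sequence $\sum_x\iota_x(A_j)$. Then $P=\lim_{j\to\infty}P^{(j)}$ in the norm $\sup\{|\cdot(B)|/\|B\|_{\mathcal H^*_\omega}: B\in\mathcal O,\ \|B\|_{\mathcal H^*_\omega}>0\}$. (b) If $(A_j)$ is Cauchy with respect to $\|\cdot\|_{\widehat{\mathcal H}_\omega}$ with limit $A\in\widehat{\mathcal H}_\omega$, let $\widehat P$ be the (unique) two-sided pseudolocal charge with $\widehat P(B)=\langle\langle A,B\rangle\rangle_\omega$ for all $B\in\mathcal O$, and let $\widehat P^{(j)}$ be the two-sided pseudolocal charge of the local sequence $\sum_x\iota_x(A_j)$. Then $\widehat P=\lim_{j\to\infty}\widehat P^{(j)}$ in the norm $\sup\{|\cdot(B)|/\|B\|_{\widehat{\mathcal H}_\omega}:B\in\mathcal O,\ \|B\|_{\widehat{\mathcal H}_\omega}>0\}$.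
   Context: Setting: Fix $D\ge1$, $\mathbb Z^D$ with $\mathrm{dist}(x,y)=\sum_i|x_i-y_i|$, $\mathtt B(n)=\{x:\mathrm{dist}(x,0)\le n\}$. $\mathcal O$ is a complex normed space with distinguished $\mathbf 1$ of norm 1, finite-dimensional subspaces $\mathcal O_X$ ($X$ finite) with $\mathcal O_\emptyset=\mathbb C\mathbf 1$, $X\subset Y\Rightarrow\mathcal O_X\subset\mathcal O_Y$, $\mathcal O_X\cap\mathcal O_Y=\mathcal O_{X\cap Y}$, $\mathcal O=\bigcup_X\mathcal O_X$; $\mathrm{supp}(A)$ smallest $X$ with $A\in\mathcal O_X$, $|A|=|\mathrm{supp}A|$, $\mathrm{dist}(A,B)$ distance of supports ($\mathrm{dist}(A,\mathbf 1)=\infty$). Completion $\mathcal A$ is a unital $C^*$-algebra, $\mathcal O_X$ are $C^*$-subalgebras, disjointly supported elements commute with union support of the product; translations $\iota_x$ are $*$-automorphisms, $\iota_x\iota_y=\iota_{x+y}$, $\mathrm{supp}(\iota_xA)=\mathrm{supp}(A)+x$. Clustering state: translation-invariant state $\omega$ with $\nu:\mathbb N\to\mathbb R^+$, $f:\mathbb Z\to\mathbb R^+$, $p>D$, $f(d)\le d^{-p}$ ($d>0$), $|\omega(AB)-\omega(A)\omega(B)|\le\nu(\ell)\|A\|\|B\|f(\mathrm{dist}(A,B))$ for $|A|,|B|<\ell$. Forms: $\langle A,B\rangle_\omega:=\sum_x(\omega(\iota_x(A)^*B)-\omega(A^* )\omega(B))$, $\langle A,B\rangle^*_\omega:=\langle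 B^*,A^*\rangle_\omega$, $\langle\langle A,B\rangle\rangle_\omega:=\tfrac12(\langle A,B\rangle_\omega+\langle A,B\rangle^*_\omega)$; $\mathcal H^*_\omega$, $\widehat{\mathcal H}_\omega$ are the Cauchy completions of $\mathcal O$ modulo the null spaces of $\langle\cdot,\cdot\rangle^*_\omega$, $\langle\langle\cdot,\cdot\rangle\rangle_\omega$ respectively, with norms $\|B\|_{\mathcal H^*_\omega}=\langle B,B\rangle^{*1/2}_\omega$, $\|B\|_{\widehat{\mathcal H}_\omega}=\langle\langle B,B\rangle\rangle_\omega^{1/2}$. Pseudolocal sequence $Q=(Q_n)$, $Q_n\in\mathcal O_{\mathtt B(n)}$: $Q'_n:=Q_n-\omega(Q_n)\mathbf 1$ satisfies (I) $\omega(Q_n'^*Q'_n)\le\gamma n^D$ for some $\gamma$, all $n$; (II) $\lim_n\omega(Q_n'^*A)$ exists for all $A\in\mathcal O$; (III) for some $0<k<1$, $\lim_n\max_{x,y\in\mathtt B(kn)}|\omega(Q_n'^*\iota_xA)-\omega(Q_n'^*\iota_yA)|=0$ for all $A$. Its right pseudolocal charge is $B\mapsto\lim_n(\omega(BQ_n)-\omega(B)\omega(Q_n))$; if also $(Q_n^* )$ is pseudolocal, its two-sided pseudolocal charge is $B\mapsto\lim_n(\tfrac12\omega(\{Q_n^*,B\})-\omega(Q_n^* )\omega(B))$. Local sequence with density $C\in\mathcal O$, $\mathrm{supp}(C)\subset\mathtt B(u)$: $Q_n=\sum_{x\in\mathtt B(n-u)}\iota_x(C)$ for $n\ge u$, $0$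 otherwise, denoted $\sum_x\iota_x(C)$. Right pseudolocal charges are in bijection with $\mathcal H^*_\omega$ via $P(B)=\langle\cdot,B\rangle^*_\omega$, and two-sided ones with $\widehat{\mathcal H}_\omega$ via $\widehat P(B)=\langle\langle\cdot,B\rangle\rangle_\omega$.
   Formalization: The right pseudolocal charge is taken as B ↦ lim(ω(BQ_n^* ) − ω(B)ω(Q_n^* )), with Q_n^* in place of Q_n; with the formula as given, part (a) fails for non-self-adjoint A_j (e.g. A_j = iS constant gives P^{(j)} = −P). *)

theory Defs
  imports "HOL-Analysis.Analysis"
begin

text \<open>Lattice Z^D is modelled as int ^ 'd with 'd a finite type, D = CARD('d).
 The C*-algebra (completion of the local algebra) is the type 'a; the complex
 scalar multiplication is the parameter sc, the involution st, translations tr,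
 local subspaces OX.\<close>

definition l1dist :: "int ^ 'd \<Rightarrow> int ^ 'd \<Rightarrow> int" where
  "l1dist x y = (\<Sum>i\<in>UNIV. \<bar>x $ i - y $ i\<bar>)"

definition lball :: "nat \<Rightarrow> (int ^ 'd) set" where
  "lball n = {x. l1dist x 0 \<le> int n}"

definition setdist :: "(int ^ 'd) set \<Rightarrow> (int ^ 'd) set \<Rightarrow> int" where
  "setdist X Y = Min {l1dist x y | x y. x \<in> X \<and> y \<in> Y}"

definition Oall :: "((int ^ 'd) set \<Rightarrow> 'a set) \<Rightarrow> 'a set" where
  "Oall OX = \<Union> {OX X | X. finite X}"

definition supp :: "((int ^ 'd) set \<Rightarrow> 'a set) \<Rightarrow> 'a \<Rightarrow> (int ^ 'd) set" where
  "supp OX A = \<Inter> {X. finite X \<and> A \<in> OX X}"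

definition sc_span :: "(complex \<Rightarrow> 'a \<Rightarrow> 'a::real_vector) \<Rightarrow> 'a set \<Rightarrow> 'a set" where
  "sc_span sc F = {(\<Sum>b\<in>F. sc (c b) b) | c. True}"

definition cstar_algebra ::
  "(complex \<Rightarrow> 'a::{real_normed_algebra_1,banach} \<Rightarrow> 'a) \<Rightarrow> ('a \<Rightarrow> 'a) \<Rightarrow> bool" where
  "cstar_algebra sc st \<longleftrightarrow>
     (\<forall>z a b. sc z (a + b) = sc z a + sc z b) \<and>
     (\<forall>z w a. sc (z + w) a = sc z a + sc w a) \<and>
     (\<forall>z w a. sc (z * w) a = sc z (sc w a)) \<and>
     (\<forall>r a. sc (complex_of_real r) a = r *\<^sub>R a) \<and>
     (\<forall>z a b. sc z (a * b) = sc z a * b \<and> sc z (a * b) = a * sc z b) \<and>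
     (\<forall>z a. norm (sc z a) = cmod z * norm a) \<and>
     (\<forall>a. st (st a) = a) \<and>
     (\<forall>a b. st (a + b) = st a + st b) \<and>
     (\<forall>z a. st (sc z a) = sc (cnj z) (st a)) \<and>
     (\<forall>a b. st (a * b) = st b * st a) \<and>
     (\<forall>a. norm (st a * a) = (norm a)\<^sup>2)"

definition quasi_local ::
  "(complex \<Rightarrow> 'a::{real_normed_algebra_1,banach} \<Rightarrow> 'a) \<Rightarrow> ('a \<Rightarrow> 'a)
   \<Rightarrow> ((int ^ 'd) set \<Rightarrow> 'a set) \<Rightarrow> (int ^ 'd \<Rightarrow> 'a \<Rightarrow> 'a) \<Rightarrow> bool" where
  "quasi_local sc st OX tr \<longleftrightarrow>
     cstar_algebra sc st \<and>
     (\<forall>X. finite X \<longrightarrow> (\<exists>F. finite F \<and> OX X = sc_span sc F)) \<and>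
     (\<forall>X. finite X \<longrightarrow> (\<forall>a\<in>OX X. \<forall>b\<in>OX X. a + b \<in> OX X \<and> a * b \<in> OX X) \<and>
                        (\<forall>a\<in>OX X. st a \<in> OX X \<and> (\<forall>z. sc z a \<in> OX X))) \<and>
     OX {} = range (\<lambda>z. sc z 1) \<and>
     (\<forall>X Y. finite Y \<longrightarrow> X \<subseteq> Y \<longrightarrow> OX X \<subseteq> OX Y) \<and>
     (\<forall>X Y. finite X \<longrightarrow> finite Y \<longrightarrow> OX X \<inter> OX Y = OX (X \<inter> Y)) \<and>
     closure (Oall OX) = UNIV \<and>
     (\<forall>X Y A B. finite X \<longrightarrow> finite Y \<longrightarrow> X \<inter> Y = {} \<longrightarrow> A \<in> OX X \<longrightarrow> B \<in> OX Y \<longrightarrow>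
        A * B = B * A \<and> (A \<noteq> 0 \<longrightarrow> B \<noteq> 0 \<longrightarrow> supp OX (A * B) = supp OX A \<union> supp OX B)) \<and>
     (\<forall>x a b. tr x (a + b) = tr x a + tr x b) \<and>
     (\<forall>x a b. tr x (a * b) = tr x a * tr x b) \<and>
     (\<forall>x z a. tr x (sc z a) = sc z (tr x a)) \<and>
     (\<forall>x a. tr x (st a) = st (tr x a)) \<and>
     (\<forall>x. tr x 1 = 1) \<and>
     (\<forall>x. bij (tr x)) \<and>
     (\<forall>x y a. tr x (tr y a) = tr (x + y) a) \<and>
     (\<forall>x. \<forall>A\<in>Oall OX. tr x A \<in> Oall OX \<and> supp OX (tr x A) = (\<lambda>y. y + x) ` supp OX A)"

definition clustering_state ::
  "(complex \<Rightarrow> 'a::{real_normed_algebra_1,banach} \<Rightarrow> 'a) \<Rightarrow> ('a \<Rightarrow> 'a)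
   \<Rightarrow> ((int ^ 'd::finite) set \<Rightarrow> 'a set) \<Rightarrow> (int ^ 'd \<Rightarrow> 'a \<Rightarrow> 'a)
   \<Rightarrow> ('a \<Rightarrow> complex) \<Rightarrow> (nat \<Rightarrow> real) \<Rightarrow> (int \<Rightarrow> real) \<Rightarrow> real \<Rightarrow> bool" where
  "clustering_state sc st OX tr \<omega> \<nu> f p \<longleftrightarrow>
     (\<forall>a b. \<omega> (a + b) = \<omega> a + \<omega> b) \<and>
     (\<forall>z a. \<omega> (sc z a) = z * \<omega> a) \<and>
     (\<forall>a. Im (\<omega> (st a * a)) = 0 \<and> Re (\<omega> (st a * a)) \<ge> 0) \<and>
     \<omega> 1 = 1 \<and>
     (\<forall>x a. \<omega> (tr x a) = \<omega> a) \<and>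
     (\<forall>l. \<nu> l \<ge> 0) \<and> (\<forall>d. f d \<ge> 0) \<and>
     p > real CARD('d) \<and>
     (\<forall>d. d > 0 \<longrightarrow> f d \<le> real_of_int d powr (- p)) \<and>
     (\<forall>l. \<forall>A\<in>Oall OX. \<forall>B\<in>Oall OX.
        card (supp OX A) < l \<longrightarrow> card (supp OX B) < l \<longrightarrow>
        supp OX A \<noteq> {} \<longrightarrow> supp OX B \<noteq> {} \<longrightarrow>
        cmod (\<omega> (A * B) - \<omega> A * \<omega> B)
          \<le> \<nu> l * norm A * norm B * f (setdist (supp OX A) (supp OX B)))"

definition form :: "('a::times \<Rightarrow> complex) \<Rightarrow> ('a \<Rightarrow> 'a) \<Rightarrow> (int ^ 'd::finite \<Rightarrow> 'a \<Rightarrow> 'a)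
   \<Rightarrow> 'a \<Rightarrow> 'a \<Rightarrow> complex" where
  "form \<omega> st tr A B = (\<Sum>\<^sub>\<infinity>x\<in>UNIV. \<omega> (st (tr x A) * B) - \<omega> (st A) * \<omega> B)"

definition form_star :: "('a::times \<Rightarrow> complex) \<Rightarrow> ('a \<Rightarrow> 'a) \<Rightarrow> (int ^ 'd::finite \<Rightarrow> 'a \<Rightarrow> 'a)
   \<Rightarrow> 'a \<Rightarrow> 'a \<Rightarrow> complex" where
  "form_star \<omega> st tr A B = form \<omega> st tr (st B) (st A)"

definition form_hat :: "('a::times \<Rightarrow> complex) \<Rightarrow> ('a \<Rightarrow> 'a) \<Rightarrow> (int ^ 'd::finite \<Rightarrow> 'a \<Rightarrow> 'a)
   \<Rightarrow> 'a \<Rightarrow> 'a \<Rightarrow> complex" where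
  "form_hat \<omega> st tr A B = (form \<omega> st tr A B + form_star \<omega> st tr A B) / 2"

definition norm_star where
  "norm_star \<omega> st tr B = sqrt (Re (form_star \<omega> st tr B B))"

definition norm_hat where
  "norm_hat \<omega> st tr B = sqrt (Re (form_hat \<omega> st tr B B))"

text \<open>Local sequence with density C supported in lball u.\<close>

definition local_seq :: "(int ^ 'd::finite \<Rightarrow> 'a \<Rightarrow> 'a::comm_monoid_add) \<Rightarrow> 'a \<Rightarrow> nat \<Rightarrow> nat \<Rightarrow> 'a" where
  "local_seq tr C u n = (if u \<le> n then (\<Sum>x\<in>lball (n - u). tr x C) else 0)"

definition right_charge :: "('a::times \<Rightarrow> complex) \<Rightarrow> ('a \<Rightarrow> 'a) \<Rightarrow> (nat \<Rightarrow> 'a) \<Rightarrow> 'a \<Rightarrow> complex" where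
  "right_charge \<omega> st Q B = lim (\<lambda>n. \<omega> (B * st (Q n)) - \<omega> B * \<omega> (st (Q n)))"

definition twosided_charge :: "('a::times \<Rightarrow> complex) \<Rightarrow> ('a \<Rightarrow> 'a) \<Rightarrow> (nat \<Rightarrow> 'a) \<Rightarrow> 'a \<Rightarrow> complex" where
  "twosided_charge \<omega> st Q B =
     lim (\<lambda>n. (\<omega> (st (Q n) * B) + \<omega> (B * st (Q n))) / 2 - \<omega> (st (Q n)) * \<omega> B)"

end

theory Submission
  imports Defs
begin

text \<open>
  Clustering with exponent \<open>p > D\<close> makes the truncated correlations absolutely summable over the lattice, so
  the charge of the local sequence with density \<open>A\<close> is exactly \<open>form_star A\<close>, respectively
  \<open>form_hat A\<close>. Both forms are positive semidefinite, because \<open>form A A\<close> is the limit of the variances of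
  the sums of translates of \<open>A\<close> over large boxes, divided by the volume. The Cauchy--Schwarz
  inequality then bounds the difference of two charges, in the dual norm, by the norm of the
  difference of their densities.
\<close>

text \<open>Summability needs the clustering bound uniformly in the translation, and that bound
  contains \<open>norm (tr x B)\<close>. Translations are only given as *-automorphisms, so their
  contractivity on local elements has to be derived. Local elements live in finite-dimensional
  *-algebras, which allows an elementary argument with powers instead of spectral theory. Positivity
  becomes visible only in finite volume: a single summand of \<open>form A A\<close> has no sign,
  but the double sum over a box is a variance. The forms may have null vectors, so Cauchy--Schwarz
  is proved for semidefinite forms and no quotient is taken.\<close>

section \<open>Finite-dimensional subspaces of a normed space\<close>

text \<open>The complement of the closed span contains a ball around \<open>v\<close>, and
  homogeneity turns its radius into a bound on the \<open>v\<close>-coefficient of any vector of the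
  enlarged span. This control drives both inductions below.\<close>

lemma span_insert_dist_pos:
  fixes v :: "'a::real_normed_vector"
  assumes "closed (span S)" and "v \<notin> span S"
  obtains \<delta> where "\<delta> > 0" and "\<And>s c. s \<in> span S \<Longrightarrow> \<bar>c\<bar> * \<delta> \<le> norm (s + c *\<^sub>R v)"
proof -
  from assms obtain \<delta> where \<delta>: "\<delta> > 0" "ball v \<delta> \<subseteq> - span S"
    by (metis ComplI open_Compl open_contains_ball)
  have "\<bar>c\<bar> * \<delta> \<le> norm (s + c *\<^sub>R v)" if "s \<in> span S" for s c
  proof (cases "c = 0")
    case False
    have "(- inverse c) *\<^sub>R s \<in> span S" using that by (simp add: span_scale span_neg)
    then have "\<delta> \<le> dist v ((- inverse c) *\<^sub>R s)" using \<delta>(2) by (meson ComplD in_mono linorder_not_le mem_ball)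
    then have "\<bar>c\<bar> * \<delta> \<le> \<bar>c\<bar> * norm (v + inverse c *\<^sub>R s)"
      by (simp add: dist_norm mult_left_mono)
    also have "\<dots> = norm (c *\<^sub>R (v + inverse c *\<^sub>R s))" by simp
    also have "c *\<^sub>R (v + inverse c *\<^sub>R s) = s + c *\<^sub>R v" using False by (simp add: algebra_simps)
    finally show ?thesis .
  qed auto
  with \<delta>(1) show ?thesis using that by blast
qed

text \<open>Induction on the generators: along a convergent sequence the coefficients of a new
  direction are Cauchy, and the remainders converge inside the smaller span, which is already
  closed.\<close>

lemma closed_span_finite:
  fixes S :: "'a::real_normed_vector set"
  assumes "finite S"
  shows "closed (span S)"
  using assms
proof (induction S)
  case (insert v S)
  show ?case
  proof (cases "v \<in> span S")
    case True
    then show ?thesis using insert by (simp add: span_redundant)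
  next
    case False
    obtain \<delta> where \<delta>: "\<delta> > 0" "\<And>s c. s \<in> span S \<Longrightarrow> \<bar>c\<bar> * \<delta> \<le> norm (s + c *\<^sub>R v)"
      using span_insert_dist_pos insert.IH False by blast
    show ?thesis
      unfolding closed_sequential_limits
    proof safe
      fix a l assume a: "\<forall>n. a n \<in> span (insert v S)" and l: "a \<longlonglongrightarrow> l"
      then have "\<forall>n. \<exists>c. a n - c *\<^sub>R v \<in> span S" by (simp add: span_breakdown_eq)
      then obtain c where c: "\<And>n. a n - c n *\<^sub>R v \<in> span S" by metis
      have "\<bar>c m - c n\<bar> * \<delta> \<le> norm (a m - a n)" for m n
        using \<delta>(2)[OF span_diff[OF c[of m] c[of n]], of "c m - c n"] by (simp add: algebra_simps)
      then have dist_c: "dist (c m) (c n) \<le> norm (a m - a n) / \<delta>" for m n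
        using \<delta>(1) by (simp add: dist_norm pos_le_divide_eq)
      have "Cauchy c"
      proof (rule metric_CauchyI)
        fix e :: real assume "e > 0"
        then have "e * \<delta> > 0" using \<delta> by simp
        then obtain M where "\<forall>m\<ge>M. \<forall>n\<ge>M. norm (a m - a n) < e * \<delta>"
          using LIMSEQ_imp_Cauchy[OF l] unfolding Cauchy_iff by blast
        then have "\<forall>m\<ge>M. \<forall>n\<ge>M. norm (a m - a n) / \<delta> < e" using \<delta>(1) by (simp add: pos_divide_less_eq)
        then show "\<exists>M. \<forall>m\<ge>M. \<forall>n\<ge>M. dist (c m) (c n) < e" using dist_c by (meson le_less_trans)
      qed
      then obtain d where "c \<longlonglongrightarrow> d" using Cauchy_convergent_iff convergent_def by blast
      then have "(\<lambda>n. a n - c n *\<^sub>R v) \<longlonglongrightarrow> l - d *\<^sub>R v" by (intro tendsto_intros l)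
      then have "l - d *\<^sub>R v \<in> span S" by (rule closed_sequentially[OF insert.IH c])
      then show "l \<in> span (insert v S)" using span_breakdown_eq by blast
    qed
  qed
qed auto

text \<open>Serves to bound translations, for which no continuity is assumed.\<close>

lemma linear_bounded_on_span_finite:
  fixes T :: "'a::real_normed_vector \<Rightarrow> 'b::real_normed_vector"
  assumes "linear T" and "finite S"
  shows "\<exists>C. \<forall>a\<in>span S. norm (T a) \<le> C * norm a"
  using assms(2)
proof (induction S)
  case empty
  show ?case using linear_0[OF assms(1)] by simp
next
  case (insert v S)
  show ?case
  proof (cases "v \<in> span S")
    case True
    then show ?thesis using insert by (simp add: span_redundant)
  next
    case False
    obtain \<delta> where \<delta>: "\<delta> > 0" "\<And>s c. s \<in> span S \<Longrightarrow> \<bar>c\<bar> * \<delta> \<le> norm (s + c *\<^sub>R v)"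
      using span_insert_dist_pos closed_span_finite[OF insert.hyps(1)] False by blast
    from insert.IH obtain C where C: "\<And>a. a \<in> span S \<Longrightarrow> norm (T a) \<le> C * norm a" by blast
    \<comment> \<open>The component of \<open>a\<close> in \<open>span S\<close> has norm at most
      \<open>norm a * (1 + norm v / \<delta>)\<close>, and its \<open>v\<close>-coefficient is at
      most \<open>norm a / \<delta>\<close>.\<close>
    have "norm (T a) \<le> (\<bar>C\<bar> * (1 + norm v / \<delta>) + norm (T v) / \<delta>) * norm a" if "a \<in> span (insert v S)" for a
    proof -
      obtain c where c: "a - c *\<^sub>R v \<in> span S" using \<open>a \<in> _\<close> span_breakdown_eq by blast
      have cb: "\<bar>c\<bar> \<le> norm a / \<delta>" using \<delta>(2)[OF c, of c] \<delta>(1) by (simp add: pos_le_divide_eq)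
      have "T a = T (a - c *\<^sub>R v) + c *\<^sub>R T v"
        using assms(1) by (simp add: linear_diff linear_scale)
      then have "norm (T a) \<le> norm (T (a - c *\<^sub>R v)) + \<bar>c\<bar> * norm (T v)"
        by (metis norm_scaleR norm_triangle_ineq)
      also have "\<dots> \<le> \<bar>C\<bar> * norm (a - c *\<^sub>R v) + \<bar>c\<bar> * norm (T v)"
        using C[OF c] by (smt (verit) abs_ge_self mult_right_mono norm_ge_zero)
      also have "\<dots> \<le> \<bar>C\<bar> * (norm a + \<bar>c\<bar> * norm v) + \<bar>c\<bar> * norm (T v)"
        by (intro add_right_mono mult_left_mono) (use norm_triangle_ineq4[of a "c *\<^sub>R v"] in auto)
      also have "\<dots> \<le> \<bar>C\<bar> * (norm a + norm a / \<delta> * norm v) + norm a / \<delta> * norm (T v)"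
        by (intro add_mono mult_left_mono mult_right_mono cb) auto
      finally show ?thesis by (simp add: algebra_simps)
    qed
    then show ?thesis by blast
  qed
qed

text \<open>If \<open>y < x\<close>, the ratio \<open>(x / y) ^ (2 ^ n)\<close> outgrows
  \<open>C\<close>. The exponents are powers of two because these are what iterating the C*-identity
  yields.\<close>

lemma le_if_power2_power_le:
  fixes x y C :: real
  assumes "0 \<le> y" and le: "\<And>n. x ^ (2 ^ n) \<le> C * y ^ (2 ^ n)"
  shows "x \<le> y"
proof (rule ccontr)
  assume "\<not> x \<le> y"
  then have xy: "y < x" by simp
  have C: "C > 0"
  proof (rule ccontr)
    assume "\<not> C > 0"
    then have "C * y \<le> 0" using assms(1) by (simp add: mult_le_0_iff)
    then show False using le[of 0] xy assms(1) by simp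
  qed
  show False
  proof (cases "y = 0")
    case True
    then show False using le[of 0] xy by simp
  next
    case False
    then have y: "y > 0" using assms(1) by simp
    have "x / y > 1" using xy y by simp
    then obtain n where n: "C < (x / y) ^ n" using real_arch_pow by blast
    also have "\<dots> \<le> (x / y) ^ (2 ^ n)"
      using \<open>x / y > 1\<close> by (intro power_increasing) (auto simp: less_imp_le)
    also have "\<dots> \<le> C" using le[of n] y by (simp add: power_divide pos_divide_le_eq)
    finally show False by simp
  qed
qed

section \<open>Positive semidefinite sesquilinear forms\<close>

text \<open>One setting for the form \<open>\<omega> (st a * b)\<close> of the state and for the
  three lattice forms. The carrier \<open>V\<close> is there because the latter are controlled only
  on local elements. No module laws for \<open>sc\<close> are assumed, so closure under differences
  is listed separately.\<close>

locale psd_sesquilinear =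
  fixes sc :: "complex \<Rightarrow> 'a::ab_group_add \<Rightarrow> 'a" and V :: "'a set" and h :: "'a \<Rightarrow> 'a \<Rightarrow> complex"
  assumes add_closed: "a \<in> V \<Longrightarrow> b \<in> V \<Longrightarrow> a + b \<in> V"
    and diff_closed: "a \<in> V \<Longrightarrow> b \<in> V \<Longrightarrow> a - b \<in> V"
    and sc_closed: "a \<in> V \<Longrightarrow> sc z a \<in> V"
    and add_left: "a \<in> V \<Longrightarrow> b \<in> V \<Longrightarrow> c \<in> V \<Longrightarrow> h (a + b) c = h a c + h b c"
    and add_right: "a \<in> V \<Longrightarrow> b \<in> V \<Longrightarrow> c \<in> V \<Longrightarrow> h c (a + b) = h c a + h c b"
    and sc_left: "a \<in> V \<Longrightarrow> c \<in> V \<Longrightarrow> h (sc z a) c = cnj z * h a c"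
    and sc_right: "a \<in> V \<Longrightarrow> c \<in> V \<Longrightarrow> h c (sc z a) = z * h c a"
    and nonneg_Re: "a \<in> V \<Longrightarrow> Re (h a a) \<ge> 0"
    and zero_Im: "a \<in> V \<Longrightarrow> Im (h a a) = 0"
begin

lemma diff_left: "a \<in> V \<Longrightarrow> b \<in> V \<Longrightarrow> c \<in> V \<Longrightarrow> h (a - b) c = h a c - h b c"
  using add_left[of "a - b" b c] diff_closed by (simp add: algebra_simps)

lemma expand:
  assumes "a \<in> V" "b \<in> V"
  shows "h (a + sc z b) (a + sc z b) = h a a + z * h a b + cnj z * h b a + cnj z * z * h b b"
  using assms by (simp add: add_left add_right sc_left sc_right sc_closed add_closed algebra_simps)

text \<open>Polarisation: the diagonal is real, so \<open>z = 1\<close> matches the imaginary parts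
  of the two mixed terms and \<open>z = \<i>\<close> their real parts.\<close>

lemma hermitian:
  assumes "a \<in> V" "b \<in> V"
  shows "h b a = cnj (h a b)"
proof -
  have im: "Im (h a a + z * h a b + cnj z * h b a + cnj z * z * h b b) = 0" for z
    using zero_Im[of "a + sc z b"] assms by (simp add: expand add_closed sc_closed)
  show ?thesis
    using im[of 1] im[of \<i>] zero_Im[OF assms(1)] zero_Im[OF assms(2)]
    by (simp add: complex_eq_iff)
qed

lemma Cauchy_Schwarz:
  assumes "a \<in> V" "b \<in> V"
  shows "cmod (h a b) \<le> sqrt (Re (h a a)) * sqrt (Re (h b b))"
proof -
  define w where "w = h a b"
  have *: "0 \<le> Re (h a a) - 2 * t * (cmod w)\<^sup>2 + t\<^sup>2 * (cmod w)\<^sup>2 * Re (h b b)" for t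
  proof -
    \<comment> \<open>The factor \<open>cnj w\<close> rotates the cross terms onto the real axis and
      leaves a real quadratic polynomial in \<open>t\<close>.\<close>
    let ?z = "- of_real t * cnj w"
    have "h (a + sc ?z b) (a + sc ?z b) = h a a - of_real (2 * t) * (w * cnj w) + of_real (t\<^sup>2) * (w * cnj w) * h b b"
      using assms by (simp add: expand hermitian[of a b] flip: w_def) (simp add: algebra_simps power2_eq_square)
    also have "w * cnj w = of_real ((cmod w)\<^sup>2)" by (rule complex_norm_square[symmetric])
    finally have eq: "h (a + sc ?z b) (a + sc ?z b) = h a a - of_real (2 * t) * of_real ((cmod w)\<^sup>2) + of_real (t\<^sup>2) * of_real ((cmod w)\<^sup>2) * h b b" .
    have Re_eq: "Re (x - of_real p * of_real q + of_real r * of_real q * y) = Re x - p * q + r * q * Re y" for x y p q r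
      by simp
    show ?thesis
      using nonneg_Re[of "a + sc ?z b"] assms unfolding eq Re_eq by (simp add: add_closed sc_closed)
  qed
  have "(cmod w)\<^sup>2 \<le> Re (h a a) * Re (h b b)"
  proof (cases "Re (h b b) = 0")
    case True
    have "w = 0"
    proof (rule ccontr)
      assume "w \<noteq> 0"
      \<comment> \<open>With \<open>h b b\<close> vanishing the polynomial is affine in
        \<open>t\<close>, and this \<open>t\<close> gives it the value -1.\<close>
      then show False using *[of "(Re (h a a) + 1) / (2 * (cmod w)\<^sup>2)"] True by simp
    qed
    then show ?thesis using True by simp
  next
    case False
    then have pos: "Re (h b b) > 0" using nonneg_Re[OF assms(2)] by simp
    \<comment> \<open>This \<open>t\<close> minimises the polynomial when \<open>w\<close> is
      nonzero.\<close>
    show ?thesis using *[of "1 / Re (h b b)"] pos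
      by (simp add: field_simps power2_eq_square)
  qed
  then show ?thesis unfolding w_def
    by (metis norm_ge_zero real_le_rsqrt real_sqrt_mult)
qed

text \<open>The pointwise limit stands for pairing with the limit of \<open>A\<close> in the
  completion. The Cauchy--Schwarz bound for \<open>h (A i - A j) B\<close> survives \<open>i\<close>
  tending to infinity, and it involves \<open>B\<close> only through its seminorm.\<close>

lemma lim_uniform:
  assumes A: "\<And>j. A j \<in> V"
    and cauchy: "\<forall>\<epsilon>>0. \<exists>N. \<forall>m\<ge>N. \<forall>n\<ge>N. sqrt (Re (h (A m - A n) (A m - A n))) < \<epsilon>"
    and "\<epsilon> > 0"
  shows "\<exists>N. \<forall>j\<ge>N. \<forall>B\<in>V. cmod (lim (\<lambda>i. h (A i) B) - h (A j) B) \<le> \<epsilon> * sqrt (Re (h B B))"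
proof -
  have bound: "cmod (h (A m) B - h (A n) B) \<le> sqrt (Re (h (A m - A n) (A m - A n))) * sqrt (Re (h B B))"
    if "B \<in> V" for m n B
    using Cauchy_Schwarz[of "A m - A n" B] that A by (simp add: diff_left diff_closed)
  have conv: "convergent (\<lambda>i. h (A i) B)" if B: "B \<in> V" for B
  proof -
    \<comment> \<open>Adding 1 keeps the divisor positive when \<open>B\<close> is a null
      vector.\<close>
    let ?k = "sqrt (Re (h B B)) + 1"
    have k: "?k > 0" using nonneg_Re[OF B] by (simp add: add_nonneg_pos)
    have "Cauchy (\<lambda>i. h (A i) B)"
    proof (rule CauchyI)
      fix e :: real assume "e > 0"
      then obtain N where N: "\<forall>m\<ge>N. \<forall>n\<ge>N. sqrt (Re (h (A m - A n) (A m - A n))) < e / ?k"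
        using cauchy k by (meson divide_pos_pos)
      have "norm (h (A m) B - h (A n) B) < e" if "m \<ge> N" "n \<ge> N" for m n
      proof -
        have "sqrt (Re (h (A m - A n) (A m - A n))) * sqrt (Re (h B B)) \<le> sqrt (Re (h (A m - A n) (A m - A n))) * ?k"
          using nonneg_Re A diff_closed by (intro mult_left_mono) auto
        also have "\<dots> < e" using N that k by (simp add: pos_less_divide_eq)
        finally show ?thesis using bound[OF B, of m n] by simp
      qed
      then show "\<exists>M. \<forall>m\<ge>M. \<forall>n\<ge>M. norm (h (A m) B - h (A n) B) < e" by blast
    qed
    then show ?thesis by (simp add: Cauchy_convergent_iff)
  qed
  from cauchy \<open>\<epsilon> > 0\<close> obtain N where N: "\<forall>m\<ge>N. \<forall>n\<ge>N. sqrt (Re (h (A m - A n) (A m - A n))) < \<epsilon>" by blast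
  have "cmod (lim (\<lambda>i. h (A i) B) - h (A j) B) \<le> \<epsilon> * sqrt (Re (h B B))" if "j \<ge> N" "B \<in> V" for j B
  proof (rule Lim_norm_ubound[of sequentially])
    show "(\<lambda>i. h (A i) B - h (A j) B) \<longlonglongrightarrow> lim (\<lambda>i. h (A i) B) - h (A j) B"
      using conv[OF \<open>B \<in> V\<close>] by (intro tendsto_intros) (simp add: convergent_LIMSEQ_iff)
    show "\<forall>\<^sub>F i in sequentially. cmod (h (A i) B - h (A j) B) \<le> \<epsilon> * sqrt (Re (h B B))"
      using eventually_ge_at_top[of N]
    proof eventually_elim
      case (elim i)
      then have "sqrt (Re (h (A i - A j) (A i - A j))) * sqrt (Re (h B B)) \<le> \<epsilon> * sqrt (Re (h B B))"
        using N that nonneg_Re by (intro mult_right_mono) (auto simp: less_imp_le)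
      then show ?case using bound[OF \<open>B \<in> V\<close>, of i j] by simp
    qed
  qed simp
  then show ?thesis by blast
qed

end

section \<open>Sums over the lattice\<close>

lemma l1dist_nonneg: "0 \<le> l1dist x y"
  by (simp add: l1dist_def sum_nonneg)

lemma l1dist_coord_le: "\<bar>x $ i - y $ i\<bar> \<le> l1dist x (y :: int ^ 'd::finite)"
  unfolding l1dist_def by (rule member_le_sum) auto

lemma l1dist_minus_zero: "l1dist (- x) 0 = l1dist x 0"
  by (simp add: l1dist_def)

lemma l1dist_shift_ge: "l1dist (s + x) t \<ge> l1dist x 0 - l1dist s t"
proof -
  have "l1dist x 0 \<le> (\<Sum>i\<in>UNIV. \<bar>(s + x) $ i - t $ i\<bar> + \<bar>s $ i - t $ i\<bar>)"
    unfolding l1dist_def by (rule sum_mono) auto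
  then show ?thesis by (simp add: l1dist_def sum.distrib)
qed

text \<open>Balls of the maximum norm. Being products of intervals, they let sums of product
  functions factor and have an explicit cardinality, which \<open>lball\<close> does not
  offer.\<close>

definition lbox :: "nat \<Rightarrow> (int ^ 'd) set" where
  "lbox n = {x. \<forall>i. \<bar>x $ i\<bar> \<le> int n}"

lemma bij_betw_lbox:
  "bij_betw vec_nth (lbox n :: (int ^ 'd::finite) set) (PiE UNIV (\<lambda>_. {- int n..int n}))"
proof (rule bij_betw_byWitness[where f' = vec_lambda])
  show "vec_nth ` lbox n \<subseteq> PiE UNIV (\<lambda>_. {- int n..int n})"
    by (auto simp: lbox_def abs_le_iff minus_le_iff)
  show "vec_lambda ` PiE UNIV (\<lambda>_. {- int n..int n}) \<subseteq> lbox n"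
    by (auto simp: lbox_def abs_le_iff minus_le_iff PiE_def Pi_def)
qed auto

lemma finite_lbox: "finite (lbox n :: (int ^ 'd::finite) set)"
  using bij_betw_finite[OF bij_betw_lbox] by (simp add: finite_PiE)

lemma card_lbox: "card (lbox n :: (int ^ 'd::finite) set) = (2 * n + 1) ^ CARD('d)"
proof -
  have "card (lbox n :: (int ^ 'd) set) = card (PiE (UNIV :: 'd set) (\<lambda>_. {- int n..int n}))"
    by (rule bij_betw_same_card[OF bij_betw_lbox])
  also have "\<dots> = nat (2 * int n + 1) ^ CARD('d)"
    by (simp add: card_PiE algebra_simps)
  also have "nat (2 * int n + 1) = 2 * n + 1" by simp
  finally show ?thesis .
qed

lemma lbox_mono: "m \<le> n \<Longrightarrow> lbox m \<subseteq> lbox n"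
  unfolding lbox_def by (auto intro: order_trans)

lemma lball_mono: "m \<le> n \<Longrightarrow> lball m \<subseteq> lball n"
  by (auto simp: lball_def)

lemma lball_subset_lbox: "lball n \<subseteq> (lbox n :: (int ^ 'd::finite) set)"
proof
  fix x :: "int ^ 'd" assume "x \<in> lball n"
  then show "x \<in> lbox n"
    using l1dist_coord_le[of x _ 0] by (auto simp: lball_def lbox_def intro: order_trans)
qed

lemma finite_lball: "finite (lball n :: (int ^ 'd::finite) set)"
  using finite_subset[OF lball_subset_lbox finite_lbox] .

lemma finite_subset_lball:
  fixes F :: "(int ^ 'd::finite) set"
  assumes "finite F"
  shows "\<exists>R. F \<subseteq> lball R"
  using assms
proof (induction F)
  case (insert x F)
  then obtain R where R: "F \<subseteq> lball R" by blast
  let ?R = "max R (nat (l1dist x 0))"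
  have "x \<in> lball ?R" using l1dist_nonneg[of x 0] by (auto simp: lball_def)
  moreover have "F \<subseteq> lball ?R" using R lball_mono[of R ?R] by auto
  ultimately show ?case by blast
qed auto

text \<open>Unconditional summation is a limit along finite sets, and every finite set lies in some
  ball. The shift by \<open>u\<close> is the one in \<open>local_seq\<close>.\<close>

lemma has_sum_lball_tendsto:
  fixes g :: "int ^ 'd::finite \<Rightarrow> 'b::{comm_monoid_add, topological_space}"
  assumes "(g has_sum s) UNIV"
  shows "(\<lambda>n. \<Sum>x\<in>lball (n - u). g x) \<longlonglongrightarrow> s"
proof -
  have "filterlim (lball :: nat \<Rightarrow> (int ^ 'd) set) (finite_subsets_at_top UNIV) sequentially"
    unfolding filterlim_iff eventually_finite_subsets_at_top
  proof safe
    fix P and X :: "(int ^ 'd) set"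
    assume "finite X" and P: "\<forall>Y. finite Y \<and> X \<subseteq> Y \<and> Y \<subseteq> UNIV \<longrightarrow> P Y"
    then obtain R where R: "X \<subseteq> lball R" using finite_subset_lball by blast
    have "P (lball n)" if "n \<ge> R" for n
      using order_trans[OF R lball_mono[OF that]] by (intro P[rule_format]) (simp add: finite_lball)
    then show "\<forall>\<^sub>F n in sequentially. P (lball n)" by (rule eventually_sequentiallyI)
  qed
  from filterlim_compose[OF assms[unfolded has_sum_def] this]
  have "(\<lambda>n. \<Sum>x\<in>lball n. g x) \<longlonglongrightarrow> s" .
  from filterlim_compose[OF this filterlim_minus_const_nat_at_top] show ?thesis .
qed

lemma sum_lball_minus: "(\<Sum>x\<in>lball n. g (- x)) = (\<Sum>x\<in>lball n. g x)"
  by (rule sum.reindex_bij_witness[of _ uminus uminus]) (auto simp: lball_def l1dist_minus_zero)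

lemma sum_powr_int_bounded:
  assumes "q > 1"
  shows "\<exists>C. \<forall>n. (\<Sum>k\<in>{- int n..int n}. (1 + real_of_int \<bar>k\<bar>) powr (- q)) \<le> C"
proof -
  let ?f = "\<lambda>k::nat. (1 + real k) powr (- q)"
  have "summable (\<lambda>k. real k powr (- q))" using assms by (simp add: summable_real_powr_iff)
  then have "summable (\<lambda>k. real (Suc k) powr (- q))" by (subst summable_Suc_iff)
  then have sum: "summable ?f" by (simp add: add.commute)
  have "(\<Sum>k\<in>{- int n..int n}. (1 + real_of_int \<bar>k\<bar>) powr (- q)) \<le> 2 * suminf ?f" for n
  proof -
    let ?g = "\<lambda>k::int. (1 + real_of_int \<bar>k\<bar>) powr (- q)"
    \<comment> \<open>Both half-lines contain 0; counting it twice only enlarges the bound.\<close>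
    let ?P = "int ` {..n}" and ?N = "(\<lambda>k. - int k) ` {..n}"
    have sub: "{- int n..int n} \<subseteq> ?P \<union> ?N"
    proof
      fix k assume k: "k \<in> {- int n..int n}"
      show "k \<in> ?P \<union> ?N"
      proof (cases "k \<ge> 0")
        case True
        then have "k = int (nat k)" "nat k \<le> n" using k by auto
        then show ?thesis by blast
      next
        case False
        then have "k = - int (nat (- k))" "nat (- k) \<le> n" using k by auto
        then show ?thesis by blast
      qed
    qed
    have "sum ?g {- int n..int n} \<le> sum ?g (?P \<union> ?N)" by (rule sum_mono2[OF _ sub]) auto
    also have "\<dots> \<le> sum ?g ?P + sum ?g ?N" by (subst sum_Un) (auto intro: sum_nonneg)
    also have "sum ?g ?P = sum ?f {..n}" by (subst sum.reindex) (auto simp: inj_on_def)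
    also have "sum ?g ?N = sum ?f {..n}" by (subst sum.reindex) (auto simp: inj_on_def)
    finally show ?thesis using sum_le_suminf[OF sum, of "{..n}"] by simp
  qed
  then show ?thesis by blast
qed

text \<open>The decay is shared evenly among the coordinates: since each coordinate is at most
  \<open>l1dist x 0\<close>, the function lies below a product of one-dimensional ones with exponent
  \<open>?q > 1\<close>, whose box sums are powers of a bounded sum.\<close>

lemma summable_on_lattice_powr:
  assumes p: "p > real CARD('d::finite)"
  shows "(\<lambda>x::int ^ 'd. (1 + real_of_int (l1dist x 0)) powr (- p)) summable_on UNIV"
proof -
  let ?D = "real CARD('d)"
  let ?q = "p / ?D"
  have D: "?D > 0" by simp
  have q: "?q > 1" using p D by (simp add: pos_less_divide_eq del: zero_less_card_finite)
  let ?f = "\<lambda>x::int ^ 'd. (1 + real_of_int (l1dist x 0)) powr (- p)"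
  let ?g = "\<lambda>k::int. (1 + real_of_int \<bar>k\<bar>) powr (- ?q)"
  obtain C where C: "\<And>n. (\<Sum>k\<in>{- int n..int n}. ?g k) \<le> C"
    using sum_powr_int_bounded[OF q] by blast
  have fg: "?f x \<le> (\<Prod>i\<in>UNIV. ?g (x $ i))" for x
  proof -
    let ?r = "1 + real_of_int (l1dist x 0)"
    have r: "?r > 0" using l1dist_nonneg[of x 0] by linarith
    have "?f x = (\<Prod>i\<in>(UNIV::'d set). ?r powr (- ?q))"
      using r by (simp add: powr_power)
    also have "\<dots> \<le> (\<Prod>i\<in>UNIV. ?g (x $ i))"
    proof (rule prod_mono, safe)
      fix i
      have "\<bar>x $ i\<bar> \<le> l1dist x 0" using l1dist_coord_le[of x i 0] by simp
      then have "1 + real_of_int \<bar>x $ i\<bar> \<le> ?r" by linarith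
      then show "?r powr (- ?q) \<le> ?g (x $ i)"
        using q by (intro powr_mono2') auto
    qed auto
    finally show ?thesis .
  qed
  show ?thesis
  proof (rule nonneg_bounded_partial_sums_imp_summable_on)
    show "\<forall>\<^sub>F X in finite_subsets_at_top UNIV. sum ?f X \<le> C ^ CARD('d)"
    proof (rule eventually_finite_subsets_at_top_weakI)
      fix X :: "(int ^ 'd) set" assume "finite X"
      then obtain n where "X \<subseteq> lball n" using finite_subset_lball by blast
      then have X: "X \<subseteq> lbox n" using lball_subset_lbox by blast
      have "sum ?f X \<le> sum ?f (lbox n)" by (rule sum_mono2[OF finite_lbox X]) simp
      also have "\<dots> \<le> (\<Sum>x\<in>(lbox n :: (int ^ 'd) set). \<Prod>i\<in>UNIV. ?g (x $ i))" by (rule sum_mono) (rule fg)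
      also have "\<dots> = (\<Sum>h\<in>PiE (UNIV::'d set) (\<lambda>_. {- int n..int n}). \<Prod>i\<in>UNIV. ?g (h i))"
        by (rule sum.reindex_bij_betw[OF bij_betw_lbox])
      also have "\<dots> = (\<Prod>i\<in>(UNIV::'d set). \<Sum>k\<in>{- int n..int n}. ?g k)"
        by (rule prod_sum_PiE[symmetric]) auto
      also have "\<dots> \<le> C ^ CARD('d)"
        using C by (simp add: power_mono sum_nonneg)
      finally show "sum ?f X \<le> C ^ CARD('d)" .
    qed
  qed auto
qed

text \<open>For \<open>y\<close> deep inside the box, the inner sum runs over a translated box that
  still contains the finite set carrying the sum of \<open>g\<close> up to a small error. The other
  \<open>y\<close> form a boundary layer of vanishing proportion, on which the inner sum is bounded
  by the absolute sum.\<close>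

lemma lbox_average_tendsto:
  fixes g :: "int ^ 'd::finite \<Rightarrow> complex"
  assumes abs: "(\<lambda>x. cmod (g x)) summable_on UNIV"
  shows "(\<lambda>n. (\<Sum>y\<in>lbox n. \<Sum>x\<in>lbox n. g (x - y)) / of_nat (card (lbox n :: (int ^ 'd) set)))
    \<longlonglongrightarrow> infsum g UNIV"
proof (rule LIMSEQ_I)
  fix e :: real assume "e > 0"
  define S where "S = infsum g UNIV"
  define M where "M = infsum (\<lambda>x. cmod (g x)) UNIV"
  define c where "c n = real (card (lbox n :: (int ^ 'd) set))" for n
  have c: "c n = (2 * real n + 1) ^ CARD('d)" for n by (simp add: c_def card_lbox add.commute)
  have cpos: "c n > 0" for n by (simp add: c)
  have M: "M \<ge> 0" unfolding M_def by (rule infsum_nonneg) simp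
  have SM: "cmod S \<le> M" unfolding S_def M_def using norm_infsum_bound[OF abs] .
  have "(g has_sum S) UNIV" unfolding S_def using abs abs_summable_summable has_sum_infsum by blast
  then have "\<forall>\<^sub>F X in finite_subsets_at_top UNIV. dist (sum g X) S < e / 2"
    using \<open>e > 0\<close> unfolding has_sum_def tendsto_iff by (metis half_gt_zero)
  then obtain F where F: "finite F" "\<And>X. finite X \<Longrightarrow> F \<subseteq> X \<Longrightarrow> dist (sum g X) S < e / 2"
    unfolding eventually_finite_subsets_at_top by auto
  obtain R where "F \<subseteq> lball R" using F(1) finite_subset_lball by blast
  then have R: "F \<subseteq> lbox R" using lball_subset_lbox by blast
  define I where "I n y = (\<Sum>x\<in>lbox n. g (x - y))" for n y
  have I_eq: "I n y = sum g ((\<lambda>x. x - y) ` lbox n)" for n y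
    unfolding I_def by (subst sum.reindex) (auto simp: inj_on_def)
  have I_M: "cmod (I n y) \<le> M" for n y
  proof -
    have "cmod (I n y) \<le> (\<Sum>x\<in>(\<lambda>x. x - y) ` lbox n. cmod (g x))" unfolding I_eq by (rule norm_sum)
    also have "\<dots> \<le> M" unfolding M_def by (rule finite_sum_le_infsum[OF abs]) (auto simp: finite_lbox)
    finally show ?thesis .
  qed
  have I_far: "cmod (I n y - S) \<le> 2 * M" for n y
    using norm_triangle_ineq4[of "I n y" S] I_M[of n y] SM by linarith
  have I_near: "cmod (I n y - S) \<le> e / 2" if n: "n \<ge> R" and y: "y \<in> lbox (n - R)" for n y
  proof -
    have "lbox R \<subseteq> (\<lambda>x. x - y) ` lbox n"
    proof
      fix z :: "int ^ 'd" assume z: "z \<in> lbox R"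
      have "\<bar>(z + y) $ i\<bar> \<le> int n" for i
      proof -
        have "\<bar>z $ i\<bar> \<le> int R" "\<bar>y $ i\<bar> \<le> int (n - R)" using z y by (auto simp: lbox_def)
        then show ?thesis using n by (simp add: of_nat_diff)
      qed
      then have "z + y \<in> lbox n" by (simp add: lbox_def)
      moreover have "z = (z + y) - y" by simp
      ultimately show "z \<in> (\<lambda>x. x - y) ` lbox n" by blast
    qed
    then have "dist (I n y) S < e / 2" unfolding I_eq using R by (intro F(2)) (auto simp: finite_lbox)
    then show ?thesis by (simp add: dist_norm)
  qed
  \<comment> \<open>The inner box contributes at most \<open>e / 2\<close> on average; the boundary
    layer has proportion \<open>1 - c (n - R) / c n\<close> and error at most \<open>2 * M\<close>
    per point.\<close>
  have main: "cmod ((\<Sum>y\<in>lbox n. I n y) / of_real (c n) - S) \<le> e / 2 + 2 * M * (1 - (1 - 2 * real R / (2 * real n + 1)) ^ CARD('d))"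
    if n: "n \<ge> R" for n
  proof -
    let ?L = "lbox n :: (int ^ 'd) set" and ?K = "lbox (n - R) :: (int ^ 'd) set"
    have KL: "?K \<subseteq> ?L" by (rule lbox_mono) simp
    have "(\<Sum>y\<in>?L. I n y - S) = (\<Sum>y\<in>?L. I n y) - of_real (c n) * S"
      by (simp add: sum_subtractf c_def)
    then have "(\<Sum>y\<in>?L. I n y) / of_real (c n) - S = (\<Sum>y\<in>?L. I n y - S) / of_real (c n)"
      using cpos[of n] by (simp add: field_simps)
    then have "cmod ((\<Sum>y\<in>?L. I n y) / of_real (c n) - S) = cmod (\<Sum>y\<in>?L. I n y - S) / c n"
      using cpos[of n] by (simp add: norm_divide)
    also have "cmod (\<Sum>y\<in>?L. I n y - S) \<le> (\<Sum>y\<in>?L. cmod (I n y - S))" by (rule norm_sum)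
    also have "\<dots> = (\<Sum>y\<in>?L - ?K. cmod (I n y - S)) + (\<Sum>y\<in>?K. cmod (I n y - S))"
      by (rule sum.subset_diff[OF KL finite_lbox])
    also have "\<dots> \<le> (\<Sum>y\<in>?L - ?K. 2 * M) + (\<Sum>y\<in>?K. e / 2)"
      by (intro add_mono sum_mono I_far I_near n)
    also have "\<dots> = 2 * M * (c n - c (n - R)) + e / 2 * c (n - R)"
      using KL by (simp add: c_def card_Diff_subset finite_lbox card_mono of_nat_diff)
    also have "\<dots> \<le> 2 * M * (c n - c (n - R)) + e / 2 * c n"
      using \<open>e > 0\<close> KL by (simp add: c_def card_mono finite_lbox)
    finally have "cmod ((\<Sum>y\<in>?L. I n y) / of_real (c n) - S) \<le> (2 * M * (c n - c (n - R)) + e / 2 * c n) / c n"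
      using cpos[of n] by (simp add: divide_right_mono less_imp_le)
    also have "\<dots> = e / 2 + 2 * M * (1 - c (n - R) / c n)"
      using cpos[of n] by (simp add: field_simps)
    also have "c (n - R) / c n = ((2 * (real n - real R) + 1) / (2 * real n + 1)) ^ CARD('d)"
      using n by (simp add: c power_divide of_nat_diff)
    also have "(2 * (real n - real R) + 1) / (2 * real n + 1) = 1 - 2 * real R / (2 * real n + 1)"
      by (simp add: field_simps)
    finally show ?thesis .
  qed
  have lin: "filterlim (\<lambda>n. 2 * real n + 1) at_infinity sequentially"
    by (rule filterlim_at_top_imp_at_infinity, rule filterlim_at_top_mono[OF filterlim_real_sequentially]) simp
  have "(\<lambda>n. e / 2 + 2 * M * (1 - (1 - 2 * real R / (2 * real n + 1)) ^ CARD('d))) \<longlonglongrightarrow> e / 2 + 2 * M * (1 - (1 - 0) ^ CARD('d))"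
    by (intro tendsto_intros tendsto_divide_0[OF tendsto_const lin])
  from order_tendstoD(2)[OF this, of e] have "\<forall>\<^sub>F n in sequentially. e / 2 + 2 * M * (1 - (1 - 2 * real R / (2 * real n + 1)) ^ CARD('d)) < e"
    using \<open>e > 0\<close> by simp
  then obtain N where N: "\<And>n. n \<ge> N \<Longrightarrow> e / 2 + 2 * M * (1 - (1 - 2 * real R / (2 * real n + 1)) ^ CARD('d)) < e"
    by (auto simp: eventually_sequentially)
  have "cmod ((\<Sum>y\<in>lbox n. \<Sum>x\<in>lbox n. g (x - y)) / of_nat (card (lbox n :: (int ^ 'd) set)) - infsum g UNIV) < e"
    if "n \<ge> max N R" for n
    using main[of n] N[of n] that by (simp add: I_def c_def S_def)
  then show "\<exists>N. \<forall>n\<ge>N. cmod ((\<Sum>y\<in>lbox n. \<Sum>x\<in>lbox n. g (x - y)) / of_nat (card (lbox n :: (int ^ 'd) set)) - infsum g UNIV) < e"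
    by blast
qed

section \<open>Decay of correlations\<close>

locale clustering_system =
  fixes sc :: "complex \<Rightarrow> 'a::{real_normed_algebra_1,banach} \<Rightarrow> 'a"
    and st :: "'a \<Rightarrow> 'a"
    and OX :: "(int ^ 'd::finite) set \<Rightarrow> 'a set"
    and tr :: "int ^ 'd \<Rightarrow> 'a \<Rightarrow> 'a"
    and \<omega> :: "'a \<Rightarrow> complex"
    and \<nu> :: "nat \<Rightarrow> real" and f :: "int \<Rightarrow> real" and p :: real
  assumes quasi_local: "quasi_local sc st OX tr"
    and clustering: "clustering_state sc st OX tr \<omega> \<nu> f p"
begin

section \<open>Consequences of the axioms for the algebra and the state\<close>

lemma cstar: "cstar_algebra sc st"
  using quasi_local unfolding quasi_local_def by blast

lemma
  shows sc_add_left: "sc (z + w) a = sc z a + sc w a"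
    and sc_mult: "sc (z * w) a = sc z (sc w a)"
    and sc_of_real: "sc (complex_of_real r) a = r *\<^sub>R a"
    and sc_mult_left: "sc z a * b = sc z (a * b)"
    and sc_mult_right: "a * sc z b = sc z (a * b)"
    and st_st [simp]: "st (st a) = a"
    and st_add: "st (a + b) = st a + st b"
    and st_sc: "st (sc z a) = sc (cnj z) (st a)"
    and st_mult: "st (a * b) = st b * st a"
    and norm_st_mult: "norm (st a * a) = (norm a)\<^sup>2"
  using cstar unfolding cstar_algebra_def by metis+

lemma
  shows tr_add: "tr x (a + b) = tr x a + tr x b"
    and tr_mult: "tr x (a * b) = tr x a * tr x b"
    and tr_sc: "tr x (sc z a) = sc z (tr x a)"
    and tr_st: "tr x (st a) = st (tr x a)"
    and tr_one: "tr x 1 = 1"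
    and bij_tr: "bij (tr x)"
    and tr_tr: "tr x (tr y a) = tr (x + y) a"
  using quasi_local unfolding quasi_local_def by metis+

lemma
  shows OX_span: "finite X \<Longrightarrow> \<exists>F. finite F \<and> OX X = sc_span sc F"
    and OX_add: "finite X \<Longrightarrow> a \<in> OX X \<Longrightarrow> b \<in> OX X \<Longrightarrow> a + b \<in> OX X"
    and OX_mult: "finite X \<Longrightarrow> a \<in> OX X \<Longrightarrow> b \<in> OX X \<Longrightarrow> a * b \<in> OX X"
    and OX_st: "finite X \<Longrightarrow> a \<in> OX X \<Longrightarrow> st a \<in> OX X"
    and OX_sc: "finite X \<Longrightarrow> a \<in> OX X \<Longrightarrow> sc z a \<in> OX X"
  using quasi_local unfolding quasi_local_def by metis+

lemma
  shows OX_empty: "OX {} = range (\<lambda>z. sc z 1)"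
    and OX_mono: "finite Y \<Longrightarrow> X \<subseteq> Y \<Longrightarrow> OX X \<subseteq> OX Y"
    and OX_Int: "finite X \<Longrightarrow> finite Y \<Longrightarrow> OX X \<inter> OX Y = OX (X \<inter> Y)"
  using quasi_local unfolding quasi_local_def by metis+

lemma
  shows Oall_tr: "A \<in> Oall OX \<Longrightarrow> tr x A \<in> Oall OX"
    and supp_tr: "A \<in> Oall OX \<Longrightarrow> supp OX (tr x A) = (\<lambda>y. y + x) ` supp OX A"
  using quasi_local unfolding quasi_local_def by metis+

lemma
  shows state_add: "\<omega> (a + b) = \<omega> a + \<omega> b"
    and state_sc: "\<omega> (sc z a) = z * \<omega> a"
    and state_pos_Im: "Im (\<omega> (st a * a)) = 0"
    and state_pos_Re: "Re (\<omega> (st a * a)) \<ge> 0"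
    and state_one: "\<omega> 1 = 1"
    and state_tr: "\<omega> (tr x a) = \<omega> a"
    and rate_nonneg: "\<nu> l \<ge> 0"
    and exponent: "p > real CARD('d)"
    and decay: "d > 0 \<Longrightarrow> f d \<le> real_of_int d powr (- p)"
    and clusters: "A \<in> Oall OX \<Longrightarrow> B \<in> Oall OX \<Longrightarrow> card (supp OX A) < l \<Longrightarrow> card (supp OX B) < l \<Longrightarrow>
        supp OX A \<noteq> {} \<Longrightarrow> supp OX B \<noteq> {} \<Longrightarrow>
        cmod (\<omega> (A * B) - \<omega> A * \<omega> B)
          \<le> \<nu> l * norm A * norm B * f (setdist (supp OX A) (supp OX B))"
  using clustering unfolding clustering_state_def by metis+

lemma sc_minus_one: "sc (- 1) a = - a"
  using sc_of_real[of "- 1" a] by simp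

lemma state_zero: "\<omega> 0 = 0"
  using state_add[of 0 0] by simp

lemma st_zero: "st 0 = 0"
  using st_add[of 0 0] by simp

lemma st_one: "st 1 = 1"
  by (metis mult_1_left mult_1_right st_mult st_st)

lemma state_sum: "\<omega> (\<Sum>i\<in>I. g i) = (\<Sum>i\<in>I. \<omega> (g i))"
  by (induction I rule: infinite_finite_induct) (simp_all add: state_zero state_add)

lemma st_sum: "st (\<Sum>i\<in>I. g i) = (\<Sum>i\<in>I. st (g i))"
  by (induction I rule: infinite_finite_induct) (simp_all add: st_zero st_add)

lemma tr_zero: "tr 0 a = a"
  using tr_tr[of 0 0 a] bij_tr[of 0] by (simp add: bij_def inj_eq)

text \<open>The pre-inner product of the GNS construction; its Hermitian symmetry against
  \<open>1\<close> gives \<open>state_st\<close>.\<close>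

lemma psd_state: "psd_sesquilinear sc UNIV (\<lambda>a b. \<omega> (st a * b))"
  by unfold_locales
    (simp_all add: st_add st_sc state_add state_sc sc_mult_left sc_mult_right algebra_simps state_pos_Im state_pos_Re)

lemma state_st: "\<omega> (st a) = cnj (\<omega> a)"
  using psd_sesquilinear.hermitian[OF psd_state, of 1 a] by (simp add: st_one)

text \<open>The expression equals \<open>\<omega> (st b * b)\<close> for the centred element
  \<open>b\<close>, that is, \<open>a\<close> minus its expectation times \<open>1\<close>.\<close>

lemma variance_nonneg:
  "Im (\<omega> (st a * a) - \<omega> (st a) * \<omega> a) = 0" "Re (\<omega> (st a * a) - \<omega> (st a) * \<omega> a) \<ge> 0"
proof -
  let ?b = "a + sc (- \<omega> a) 1"
  have "\<omega> (st ?b * ?b) = \<omega> (st a * a) - \<omega> (st a) * \<omega> a"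
    using psd_sesquilinear.expand[OF psd_state, of a 1 "- \<omega> a"]
    by (simp add: st_one state_one state_st)
  then show "Im (\<omega> (st a * a) - \<omega> (st a) * \<omega> a) = 0" "Re (\<omega> (st a * a) - \<omega> (st a) * \<omega> a) \<ge> 0"
    using state_pos_Im[of ?b] state_pos_Re[of ?b] by auto
qed

lemma OallE:
  assumes "A \<in> Oall OX"
  obtains X where "finite X" "A \<in> OX X"
  using assms by (auto simp: Oall_def)

lemma OallI: "finite X \<Longrightarrow> A \<in> OX X \<Longrightarrow> A \<in> Oall OX"
  by (auto simp: Oall_def)

lemma Oall_sc: "A \<in> Oall OX \<Longrightarrow> sc z A \<in> Oall OX"
  by (meson OX_sc OallE OallI)

lemma Oall_st: "A \<in> Oall OX \<Longrightarrow> st A \<in> Oall OX"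
  by (meson OX_st OallE OallI)

lemma Oall_add:
  assumes "A \<in> Oall OX" "B \<in> Oall OX"
  shows "A + B \<in> Oall OX"
proof -
  obtain X Y where XY: "finite X" "A \<in> OX X" "finite Y" "B \<in> OX Y" using assms OallE by metis
  then have "A \<in> OX (X \<union> Y)" "B \<in> OX (X \<union> Y)" using OX_mono[of "X \<union> Y"] by blast+
  then show ?thesis using XY by (intro OallI[of "X \<union> Y"] OX_add) auto
qed

lemma Oall_diff: "A \<in> Oall OX \<Longrightarrow> B \<in> Oall OX \<Longrightarrow> A - B \<in> Oall OX"
  using Oall_add[of A "- B"] Oall_sc[of B "- 1"] by (simp add: sc_minus_one)

text \<open>\<open>supp\<close> may intersect infinitely many regions, whereas \<open>OX_Int\<close>
  speaks of two. A localising region of least cardinality lies, by \<open>OX_Int\<close>, inside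
  every other one, hence is itself the intersection.\<close>

lemma supp_mem:
  assumes "A \<in> Oall OX"
  shows "finite (supp OX A)" "A \<in> OX (supp OX A)"
proof -
  have "\<exists>X. finite X \<and> A \<in> OX X" using assms OallE by metis
  from ex_has_least_nat[of "\<lambda>X. finite X \<and> A \<in> OX X" _ card] this
  obtain X where X: "finite X" "A \<in> OX X" and least: "\<And>Y. finite Y \<Longrightarrow> A \<in> OX Y \<Longrightarrow> card X \<le> card Y"
    by metis
  have "X \<subseteq> Y" if Y: "finite Y" "A \<in> OX Y" for Y
  proof -
    have "A \<in> OX (X \<inter> Y)" using OX_Int[OF X(1) Y(1)] X Y by blast
    then have "card X \<le> card (X \<inter> Y)" using X by (intro least) auto
    then have "X \<inter> Y = X" using X(1) by (intro card_seteq) auto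
    then show ?thesis by blast
  qed
  then have "supp OX A = X" using X by (auto simp: supp_def)
  then show "finite (supp OX A)" "A \<in> OX (supp OX A)" using X by auto
qed

lemma supp_empty_scalar:
  assumes "A \<in> Oall OX" "supp OX A = {}"
  shows "\<exists>z. A = sc z 1"
  using supp_mem(2)[OF assms(1)] assms(2) OX_empty by auto

section \<open>Contractivity of translations on local elements\<close>

lemma linear_tr: "linear (tr x)"
  by (rule linearI) (simp_all add: tr_add tr_sc flip: sc_of_real)

lemma tr_power: "tr x (a ^ n) = tr x a ^ n"
  by (induction n) (simp_all add: tr_one tr_mult)

lemma sc_eq_scaleR: "sc z a = Re z *\<^sub>R a + Im z *\<^sub>R sc \<i> a"
proof -
  have "sc z a = sc (of_real (Re z) + \<i> * of_real (Im z)) a" by (simp flip: complex_eq)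
  also have "\<dots> = Re z *\<^sub>R a + Im z *\<^sub>R sc \<i> a"
    by (simp add: sc_add_left mult.commute[of \<i>] sc_mult sc_of_real)
  finally show ?thesis .
qed

text \<open>The boundedness lemma concerns real spans, so the complex span of \<open>F\<close> is
  placed in the real span of \<open>F\<close> and its multiples by \<open>\<i>\<close>.\<close>

lemma sc_span_subset_span: "sc_span sc F \<subseteq> span (F \<union> sc \<i> ` F)"
proof
  fix a assume "a \<in> sc_span sc F"
  then obtain c where "a = (\<Sum>b\<in>F. sc (c b) b)" by (auto simp: sc_span_def)
  also have "\<dots> \<in> span (F \<union> sc \<i> ` F)"
    by (rule span_sum, subst sc_eq_scaleR, intro span_add span_scale) (auto intro: span_base)
  finally show "a \<in> span (F \<union> sc \<i> ` F)" .
qed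

text \<open>For a self-adjoint element the C*-identity computes the norm of its square, so squaring
  can be iterated once membership and self-adjointness are carried through the induction.\<close>

lemma norm_selfadjoint_power2_power:
  assumes "finite X" "b \<in> OX X" "st b = b"
  shows "norm (b ^ (2 ^ n)) = norm b ^ (2 ^ n) \<and> b ^ (2 ^ n) \<in> OX X \<and> st (b ^ (2 ^ n)) = b ^ (2 ^ n)"
proof (induction n)
  case 0
  then show ?case using assms by simp
next
  case (Suc n)
  let ?c = "b ^ (2 ^ n)"
  have eq: "b ^ (2 ^ Suc n) = ?c * ?c" by (simp add: power_add mult_2)
  have "norm (?c * ?c) = (norm ?c)\<^sup>2" using norm_st_mult[of ?c] Suc by simp
  also have "\<dots> = norm b ^ (2 ^ Suc n)" using Suc by (simp add: power_mult[symmetric] mult.commute)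
  finally show ?case unfolding eq using Suc OX_mult[OF assms(1)] by (simp add: st_mult)
qed

text \<open>On the finite-dimensional algebra of a finite region a translation is bounded by some constant;
  the constant disappears when the bound is applied to the powers of a self-adjoint element.\<close>

lemma norm_tr_le:
  assumes "A \<in> Oall OX"
  shows "norm (tr x A) \<le> norm A"
proof -
  obtain X where X: "finite X" "A \<in> OX X" using assms OallE by blast
  obtain F where F: "finite F" "OX X = sc_span sc F" using OX_span[OF X(1)] by blast
  obtain C where C: "\<And>a. a \<in> span (F \<union> sc \<i> ` F) \<Longrightarrow> norm (tr x a) \<le> C * norm a"
    using linear_bounded_on_span_finite[OF linear_tr, of "F \<union> sc \<i> ` F" x] F(1) by auto
  let ?b = "st A * A"
  have b: "?b \<in> OX X" "st ?b = ?b" using X OX_st OX_mult by (auto simp: st_mult)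
  have "norm (tr x ?b) \<le> norm ?b"
  proof (rule le_if_power2_power_le)
    fix n :: nat
    note pow = norm_selfadjoint_power2_power[OF X(1) b, of n]
    \<comment> \<open>The translated element is again local and self-adjoint, so the power identity
      holds for it in the algebra of its own support.\<close>
    have b': "tr x ?b \<in> OX (supp OX (tr x ?b))" "finite (supp OX (tr x ?b))" "st (tr x ?b) = tr x ?b"
      using supp_mem[OF Oall_tr[OF OallI[OF X(1) b(1)]]] b(2) tr_st[of x ?b] by auto
    have "norm (tr x ?b) ^ (2 ^ n) = norm (tr x ?b ^ (2 ^ n))"
      using norm_selfadjoint_power2_power[OF b'(2,1,3), of n] by simp
    also have "\<dots> = norm (tr x (?b ^ (2 ^ n)))" by (simp add: tr_power)
    also have "\<dots> \<le> C * norm (?b ^ (2 ^ n))" using pow F(2) sc_span_subset_span by (intro C) auto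
    finally show "norm (tr x ?b) ^ (2 ^ n) \<le> C * norm ?b ^ (2 ^ n)" using pow by simp
  qed simp
  moreover have "tr x ?b = st (tr x A) * tr x A" by (simp add: tr_mult tr_st)
  ultimately have "(norm (tr x A))\<^sup>2 \<le> (norm A)\<^sup>2" by (simp add: norm_st_mult)
  then show ?thesis by (rule power2_le_imp_le) simp
qed

section \<open>Summability of truncated correlations\<close>

text \<open>A finite ball is left out because the translated supports may meet there, and
  \<open>decay\<close> says nothing about \<open>f\<close> at 0. Farther out their separation grows
  like \<open>l1dist x 0\<close>.\<close>

lemma correlation_bound:
  assumes B: "B \<in> Oall OX" and C: "C \<in> Oall OX"
  shows "\<exists>K R. \<forall>x. x \<notin> lball R \<longrightarrow>
    cmod (\<omega> (tr x B * C) - \<omega> B * \<omega> C) \<le> K * (1 + real_of_int (l1dist x 0)) powr (- p)"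
proof -
  let ?S = "supp OX B" and ?T = "supp OX C"
  consider (B) "?S = {}" | (C) "?T = {}" | (ne) "?S \<noteq> {}" "?T \<noteq> {}" by blast
  then show ?thesis
  proof cases
    case B
    \<comment> \<open>\<open>clusters\<close> does not cover empty supports, but these belong to
      scalars, whose truncated correlations vanish.\<close>
    then obtain z where "B = sc z 1" using supp_empty_scalar assms by blast
    then have "\<omega> (tr x B * C) - \<omega> B * \<omega> C = 0" for x
      by (simp add: tr_sc tr_one sc_mult_left state_sc state_one)
    then show ?thesis by (intro exI[of _ 0]) simp
  next
    case C
    then obtain z where "C = sc z 1" using supp_empty_scalar assms by blast
    then have "\<omega> (tr x B * C) - \<omega> B * \<omega> C = 0" for x
      by (simp add: sc_mult_right state_sc state_one state_tr)
    then show ?thesis by (intro exI[of _ 0]) simp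
  next
    case ne
    note fin = supp_mem(1)[OF B] supp_mem(1)[OF C]
    \<comment> \<open>\<open>clusters\<close> asks for strict inequalities, hence the added
      1.\<close>
    let ?l = "max (card ?S) (card ?T) + 1"
    let ?M = "(\<lambda>(s, t). l1dist s t) ` (?S \<times> ?T)"
    define R where "R = nat (Max ?M)"
    have R: "l1dist s t \<le> int R" if "s \<in> ?S" "t \<in> ?T" for s t
    proof -
      have "l1dist s t \<le> Max ?M" using that fin by (intro Max_ge) auto
      then show ?thesis by (simp add: R_def)
    qed
    define K where "K = \<nu> ?l * norm B * norm C"
    have K: "K \<ge> 0" by (simp add: K_def rate_nonneg)
    have "cmod (\<omega> (tr x B * C) - \<omega> B * \<omega> C) \<le> (K * 2 powr p) * (1 + real_of_int (l1dist x 0)) powr (- p)"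
      if x: "x \<notin> lball (2 * R)" for x
    proof -
      let ?Sx = "(\<lambda>y. y + x) ` ?S" and ?r = "1 + real_of_int (l1dist x 0)"
      let ?d = "setdist ?Sx ?T"
      let ?Q = "{l1dist s t | s t. s \<in> ?Sx \<and> t \<in> ?T}"
      have Q: "?Q = (\<lambda>(s, t). l1dist s t) ` (?Sx \<times> ?T)" by auto
      have "?d \<in> ?Q" unfolding setdist_def by (rule Min_in) (use fin ne in \<open>auto simp: Q\<close>)
      then obtain s t where st: "s \<in> ?S" "t \<in> ?T" "?d = l1dist (s + x) t" by auto
      \<comment> \<open>Translation can lose at most \<open>R\<close> of the distance
        \<open>l1dist x 0\<close>, so beyond radius \<open>2 * R\<close> the supports are at least
        \<open>?r / 2\<close> apart; this is the source of \<open>2 powr p\<close>.\<close>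
      have x': "l1dist x 0 \<ge> 2 * int R + 1" using x by (simp add: lball_def)
      have "?d \<ge> l1dist x 0 - int R" using l1dist_shift_ge[of x s t] R[OF st(1,2)] st(3) by linarith
      then have d0: "?d > 0" "1 + l1dist x 0 \<le> 2 * ?d" using x' by linarith+
      then have "real_of_int (1 + l1dist x 0) \<le> real_of_int (2 * ?d)" by (simp only: of_int_le_iff)
      with d0 have d: "?d > 0" "?r / 2 \<le> real_of_int ?d" by simp_all
      have r: "?r > 0" using x' by linarith
      have "f ?d \<le> real_of_int ?d powr (- p)" using decay d by blast
      also have "\<dots> \<le> (?r / 2) powr (- p)"
        using exponent r d by (intro powr_mono2') auto
      also have "\<dots> = 2 powr p * ?r powr (- p)"
        using r by (simp add: powr_divide powr_minus field_simps)
      finally have f: "f ?d \<le> 2 powr p * ?r powr (- p)" .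
      have card: "card ?Sx = card ?S" by (rule card_image) (simp add: inj_on_def)
      have "cmod (\<omega> (tr x B * C) - \<omega> (tr x B) * \<omega> C)
          \<le> \<nu> ?l * norm (tr x B) * norm C * f (setdist (supp OX (tr x B)) ?T)"
        using ne card by (intro clusters Oall_tr B C) (auto simp: supp_tr[OF B])
      also have "\<dots> = (\<nu> ?l * norm (tr x B) * norm C) * f ?d" by (simp add: supp_tr[OF B])
      also have "\<dots> \<le> (\<nu> ?l * norm (tr x B) * norm C) * (2 powr p * ?r powr (- p))"
        by (rule mult_left_mono[OF f]) (simp add: rate_nonneg)
      also have "\<dots> \<le> K * (2 powr p * ?r powr (- p))"
        unfolding K_def by (intro mult_right_mono mult_left_mono norm_tr_le B) (auto simp: rate_nonneg)
      finally show ?thesis by (simp add: state_tr mult.assoc)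
    qed
    then show ?thesis by blast
  qed
qed

lemma correlation_abs_summable:
  assumes "B \<in> Oall OX" "C \<in> Oall OX"
  shows "(\<lambda>x. cmod (\<omega> (tr x B * C) - \<omega> B * \<omega> C)) summable_on UNIV"
proof -
  let ?g = "\<lambda>x. cmod (\<omega> (tr x B * C) - \<omega> B * \<omega> C)"
  let ?h = "\<lambda>x::int ^ 'd. (1 + real_of_int (l1dist x 0)) powr (- p)"
  obtain K R where KR: "\<And>x. x \<notin> lball R \<Longrightarrow> ?g x \<le> K * ?h x"
    using correlation_bound[OF assms] by blast
  have "?h summable_on - lball R"
    using summable_on_subset_banach[OF summable_on_lattice_powr[OF exponent]] by blast
  then have "(\<lambda>x. K * ?h x) summable_on - lball R" by (rule summable_on_cmult_right)
  then have "?g summable_on - lball R"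
    by (rule summable_on_comparison_test) (use KR in auto)
  moreover have "?g summable_on lball R" by (rule summable_on_finite[OF finite_lball])
  ultimately have "?g summable_on (- lball R \<union> lball R)" by (rule summable_on_Un_disjoint) auto
  then show ?thesis by (simp add: Compl_partition2)
qed

end

section \<open>The forms and the charges\<close>

context clustering_system
begin

lemma form_abs_summable:
  assumes "A \<in> Oall OX" "B \<in> Oall OX"
  shows "(\<lambda>x. cmod (\<omega> (st (tr x A) * B) - \<omega> (st A) * \<omega> B)) summable_on UNIV"
  using correlation_abs_summable[OF Oall_st[OF assms(1)] assms(2)] by (simp add: tr_st)

text \<open>A divergent \<open>infsum\<close> has the default value 0; absolute summability ensures
  that on local elements the form is a genuine sum.\<close>

lemma form_has_sum:
  assumes "A \<in> Oall OX" "B \<in> Oall OX"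
  shows "((\<lambda>x. \<omega> (st (tr x A) * B) - \<omega> (st A) * \<omega> B) has_sum form \<omega> st tr A B) UNIV"
  unfolding form_def by (rule has_sum_infsum[OF abs_summable_summable[OF form_abs_summable[OF assms]]])

text \<open>By invariance a correlation depends only on the difference of the two positions, so the
  variance of a box sum is the double sum in \<open>lbox_average_tendsto\<close>.\<close>

lemma form_self_average:
  assumes "A \<in> Oall OX"
  shows "(\<lambda>n. (\<omega> (st (\<Sum>x\<in>lbox n. tr x A) * (\<Sum>x\<in>lbox n. tr x A))
      - \<omega> (st (\<Sum>x\<in>lbox n. tr x A)) * \<omega> (\<Sum>x\<in>lbox n. tr x A)) / of_nat (card (lbox n :: (int ^ 'd) set)))
    \<longlonglongrightarrow> form \<omega> st tr A A"
proof -
  have shift: "\<omega> (st (tr (x - y) A) * A) = \<omega> (st (tr x A) * tr y A)" for x y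
    using state_tr[of y "st (tr (x - y) A) * A"] by (simp add: tr_mult tr_st tr_tr)
  have "(\<Sum>y\<in>lbox n. \<Sum>x\<in>lbox n. \<omega> (st (tr (x - y) A) * A) - \<omega> (st A) * \<omega> A)
      = \<omega> (st (\<Sum>x\<in>lbox n. tr x A) * (\<Sum>x\<in>lbox n. tr x A))
        - \<omega> (st (\<Sum>x\<in>lbox n. tr x A)) * \<omega> (\<Sum>x\<in>lbox n. tr x A)" for n
    by (subst sum.swap)
      (simp add: shift st_sum state_sum sum_product sum_subtractf state_tr state_st)
  then show ?thesis
    using lbox_average_tendsto[OF form_abs_summable[OF assms assms]] by (simp add: form_def)
qed

lemma form_self_nonneg:
  assumes "A \<in> Oall OX"
  shows "Im (form \<omega> st tr A A) = 0" "Re (form \<omega> st tr A A) \<ge> 0"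
proof -
  note lim = form_self_average[OF assms]
  show "Im (form \<omega> st tr A A) = 0"
    using tendsto_Im[OF lim] variance_nonneg(1)
    by (simp add: Im_divide_of_nat LIMSEQ_const_iff)
  show "Re (form \<omega> st tr A A) \<ge> 0"
    by (rule LIMSEQ_le_const[OF tendsto_Re[OF lim]])
      (use variance_nonneg(2) in \<open>simp add: Re_divide_of_nat\<close>)
qed

lemma psd_form: "psd_sesquilinear sc (Oall OX) (form \<omega> st tr)"
proof
  fix a b c z assume a: "a \<in> Oall OX" and c: "c \<in> Oall OX"
  have "((\<lambda>x. cnj z * (\<omega> (st (tr x a) * c) - \<omega> (st a) * \<omega> c)) has_sum cnj z * form \<omega> st tr a c) UNIV"
    by (intro has_sum_cmult_right form_has_sum a c)
  then have "((\<lambda>x. \<omega> (st (tr x (sc z a)) * c) - \<omega> (st (sc z a)) * \<omega> c) has_sum cnj z * form \<omega> st tr a c) UNIV"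
    by (simp add: tr_sc st_sc sc_mult_left state_sc algebra_simps)
  then show "form \<omega> st tr (sc z a) c = cnj z * form \<omega> st tr a c"
    unfolding form_def by (rule infsumI)
  have "((\<lambda>x. z * (\<omega> (st (tr x c) * a) - \<omega> (st c) * \<omega> a)) has_sum z * form \<omega> st tr c a) UNIV"
    by (intro has_sum_cmult_right form_has_sum a c)
  then have "((\<lambda>x. \<omega> (st (tr x c) * sc z a) - \<omega> (st c) * \<omega> (sc z a)) has_sum z * form \<omega> st tr c a) UNIV"
    by (simp add: sc_mult_right state_sc algebra_simps)
  then show "form \<omega> st tr c (sc z a) = z * form \<omega> st tr c a"
    unfolding form_def by (rule infsumI)
  assume b: "b \<in> Oall OX"
  have "((\<lambda>x. (\<omega> (st (tr x a) * c) - \<omega> (st a) * \<omega> c) + (\<omega> (st (tr x b) * c) - \<omega> (st b) * \<omega> c))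
      has_sum (form \<omega> st tr a c + form \<omega> st tr b c)) UNIV"
    by (intro has_sum_add form_has_sum a b c)
  then have "((\<lambda>x. \<omega> (st (tr x (a + b)) * c) - \<omega> (st (a + b)) * \<omega> c)
      has_sum (form \<omega> st tr a c + form \<omega> st tr b c)) UNIV"
    by (simp add: tr_add st_add state_add algebra_simps)
  then show "form \<omega> st tr (a + b) c = form \<omega> st tr a c + form \<omega> st tr b c"
    unfolding form_def[of _ _ _ "a + b"] by (rule infsumI)
  have "((\<lambda>x. (\<omega> (st (tr x c) * a) - \<omega> (st c) * \<omega> a) + (\<omega> (st (tr x c) * b) - \<omega> (st c) * \<omega> b))
      has_sum (form \<omega> st tr c a + form \<omega> st tr c b)) UNIV"
    by (intro has_sum_add form_has_sum a b c)
  then have "((\<lambda>x. \<omega> (st (tr x c) * (a + b)) - \<omega> (st c) * \<omega> (a + b))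
      has_sum (form \<omega> st tr c a + form \<omega> st tr c b)) UNIV"
    by (simp add: state_add algebra_simps)
  then show "form \<omega> st tr c (a + b) = form \<omega> st tr c a + form \<omega> st tr c b"
    unfolding form_def[of _ _ _ _ "a + b"] by (rule infsumI)
qed (simp_all add: Oall_add Oall_diff Oall_sc form_self_nonneg)

sublocale form: psd_sesquilinear sc "Oall OX" "form \<omega> st tr"
  by (rule psd_form)

text \<open>The adjoint is conjugate-linear and \<open>form_star\<close> also swaps the arguments;
  the two effects cancel, and the conjugate-linear slot stays the first.\<close>

sublocale form_star: psd_sesquilinear sc "Oall OX" "form_star \<omega> st tr"
  by unfold_locales
    (simp_all add: form_star_def st_add st_sc form.add_left form.add_right form.sc_left form.sc_right
      Oall_add Oall_diff Oall_sc Oall_st form_self_nonneg)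

sublocale form_hat: psd_sesquilinear sc "Oall OX" "form_hat \<omega> st tr"
  by unfold_locales
    (simp_all add: form_hat_def form.add_left form.add_right form.sc_left form.sc_right
      form_star.add_left form_star.add_right form_star.sc_left form_star.sc_right
      Oall_add Oall_diff Oall_sc form.nonneg_Re form.zero_Im form_star.nonneg_Re form_star.zero_Im
      field_simps)

section \<open>Charges of local sequences\<close>

lemma left_charge_tendsto:
  assumes "A \<in> Oall OX" "B \<in> Oall OX"
  shows "(\<lambda>n. \<omega> (st (local_seq tr A u n) * B) - \<omega> (st (local_seq tr A u n)) * \<omega> B) \<longlonglongrightarrow> form \<omega> st tr A B"
proof (rule Lim_transform_eventually[OF has_sum_lball_tendsto[OF form_has_sum[OF assms], of u]])
  \<comment> \<open>For \<open>n < u\<close> the local sequence is set to 0, so the identity is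
    claimed only from \<open>u\<close> on.\<close>
  show "\<forall>\<^sub>F n in sequentially. (\<Sum>x\<in>lball (n - u). \<omega> (st (tr x A) * B) - \<omega> (st A) * \<omega> B)
      = \<omega> (st (local_seq tr A u n) * B) - \<omega> (st (local_seq tr A u n)) * \<omega> B"
    using eventually_ge_at_top[of u]
    by eventually_elim
      (simp add: local_seq_def st_sum sum_distrib_right state_sum sum_subtractf state_st state_tr)
qed

text \<open>In \<open>form_star\<close> the translation acts on \<open>B\<close>, in the charge on
  the density. Invariance moves it across with the opposite sign, and the symmetry of balls under
  reflection absorbs that sign.\<close>

lemma right_charge_tendsto:
  assumes "A \<in> Oall OX" "B \<in> Oall OX"
  shows "(\<lambda>n. \<omega> (B * st (local_seq tr A u n)) - \<omega> B * \<omega> (st (local_seq tr A u n))) \<longlonglongrightarrow> form_star \<omega> st tr A B"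
proof -
  let ?g = "\<lambda>x. \<omega> (tr x B * st A) - \<omega> B * \<omega> (st A)"
  have "(?g has_sum form_star \<omega> st tr A B) UNIV"
    using form_has_sum[OF Oall_st[OF assms(2)] Oall_st[OF assms(1)]] by (simp add: form_star_def tr_st)
  note lim = has_sum_lball_tendsto[OF this, of u]
  have shift: "\<omega> (B * st (tr x A)) = \<omega> (tr (- x) B * st A)" for x
    using state_tr[of "- x" "B * st (tr x A)"] by (simp add: tr_mult tr_st tr_tr tr_zero)
  show ?thesis
  proof (rule Lim_transform_eventually[OF lim])
    show "\<forall>\<^sub>F n in sequentially. (\<Sum>x\<in>lball (n - u). ?g x)
        = \<omega> (B * st (local_seq tr A u n)) - \<omega> B * \<omega> (st (local_seq tr A u n))"
      using eventually_ge_at_top[of u]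
    proof eventually_elim
      case (elim n)
      have "(\<Sum>x\<in>lball (n - u). ?g x) = (\<Sum>x\<in>lball (n - u). ?g (- x))" by (rule sum_lball_minus[symmetric])
      also have "\<dots> = \<omega> (B * st (local_seq tr A u n)) - \<omega> B * \<omega> (st (local_seq tr A u n))"
        using elim
        by (simp add: local_seq_def st_sum sum_distrib_left state_sum sum_subtractf state_st state_tr flip: shift)
      finally show ?case .
    qed
  qed
qed

lemma twosided_charge_tendsto:
  assumes "A \<in> Oall OX" "B \<in> Oall OX"
  shows "(\<lambda>n. (\<omega> (st (local_seq tr A u n) * B) + \<omega> (B * st (local_seq tr A u n))) / 2
            - \<omega> (st (local_seq tr A u n)) * \<omega> B) \<longlonglongrightarrow> form_hat \<omega> st tr A B"
proof -
  have "(\<lambda>n. ((\<omega> (st (local_seq tr A u n) * B) - \<omega> (st (local_seq tr A u n)) * \<omega> B)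
        + (\<omega> (B * st (local_seq tr A u n)) - \<omega> B * \<omega> (st (local_seq tr A u n)))) / 2) \<longlonglongrightarrow> form_hat \<omega> st tr A B"
    unfolding form_hat_def
    by (intro tendsto_divide tendsto_add left_charge_tendsto right_charge_tendsto assms tendsto_const) simp
  then show ?thesis by (simp add: field_simps)
qed

end

text \<open>No completion is constructed: the charge of the limit is encoded as the pointwise limit
  of the pairings with \<open>A i\<close>, and convergence in the supremum norm as a bound on the
  quotients that is uniform in \<open>B\<close>.\<close>

theorem theorem5p10:
  fixes sc :: "complex \<Rightarrow> 'a::{real_normed_algebra_1,banach} \<Rightarrow> 'a"
    and st :: "'a \<Rightarrow> 'a"
    and OX :: "(int ^ 'd::finite) set \<Rightarrow> 'a set"
    and tr :: "int ^ 'd \<Rightarrow> 'a \<Rightarrow> 'a"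
    and \<omega> :: "'a \<Rightarrow> complex"
    and \<nu> :: "nat \<Rightarrow> real" and f :: "int \<Rightarrow> real" and p :: real
    and A :: "nat \<Rightarrow> 'a" and u :: "nat \<Rightarrow> nat"
  assumes "quasi_local sc st OX tr"
    and "clustering_state sc st OX tr \<omega> \<nu> f p"
    and "\<forall>j. A j \<in> Oall OX"
    and "\<forall>j. supp OX (A j) \<subseteq> lball (u j)"
  shows
   "((\<forall>\<epsilon>>0. \<exists>N. \<forall>m\<ge>N. \<forall>n\<ge>N. norm_star \<omega> st tr (A m - A n) < \<epsilon>) \<longrightarrow>
      (\<forall>j. \<forall>B\<in>Oall OX. convergent (\<lambda>n. \<omega> (B * st (local_seq tr (A j) (u j) n))
                                   - \<omega> B * \<omega> (st (local_seq tr (A j) (u j) n)))) \<and>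
      (\<forall>\<epsilon>>0. \<exists>N. \<forall>j\<ge>N. \<forall>B\<in>Oall OX. norm_star \<omega> st tr B > 0 \<longrightarrow>
          cmod (lim (\<lambda>i. form_star \<omega> st tr (A i) B)
                - right_charge \<omega> st (local_seq tr (A j) (u j)) B) / norm_star \<omega> st tr B \<le> \<epsilon>))
    \<and>
    ((\<forall>\<epsilon>>0. \<exists>N. \<forall>m\<ge>N. \<forall>n\<ge>N. norm_hat \<omega> st tr (A m - A n) < \<epsilon>) \<longrightarrow>
      (\<forall>j. \<forall>B\<in>Oall OX. convergent (\<lambda>n.
            (\<omega> (st (local_seq tr (A j) (u j) n) * B) + \<omega> (B * st (local_seq tr (A j) (u j) n))) / 2
            - \<omega> (st (local_seq tr (A j) (u j) n)) * \<omega> B)) \<and>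
      (\<forall>\<epsilon>>0. \<exists>N. \<forall>j\<ge>N. \<forall>B\<in>Oall OX. norm_hat \<omega> st tr B > 0 \<longrightarrow>
          cmod (lim (\<lambda>i. form_hat \<omega> st tr (A i) B)
                - twosided_charge \<omega> st (local_seq tr (A j) (u j)) B) / norm_hat \<omega> st tr B \<le> \<epsilon>))"
proof -
  interpret clustering_system sc st OX tr \<omega> \<nu> f p
    using assms(1,2) by unfold_locales
  have A: "A j \<in> Oall OX" for j using assms(3) by blast
  have right: "right_charge \<omega> st (local_seq tr (A j) (u j)) B = form_star \<omega> st tr (A j) B" if "B \<in> Oall OX" for j B
    unfolding right_charge_def by (rule limI[OF right_charge_tendsto[OF A that]])
  have twosided: "twosided_charge \<omega> st (local_seq tr (A j) (u j)) B = form_hat \<omega> st tr (A j) B" if "B \<in> Oall OX" for j B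
    unfolding twosided_charge_def by (rule limI[OF twosided_charge_tendsto[OF A that]])
  show ?thesis
  proof (intro conjI impI allI ballI)
    fix j B assume "B \<in> Oall OX"
    then show "convergent (\<lambda>n. \<omega> (B * st (local_seq tr (A j) (u j) n))
                                   - \<omega> B * \<omega> (st (local_seq tr (A j) (u j) n)))"
      and "convergent (\<lambda>n.
            (\<omega> (st (local_seq tr (A j) (u j) n) * B) + \<omega> (B * st (local_seq tr (A j) (u j) n))) / 2
            - \<omega> (st (local_seq tr (A j) (u j) n)) * \<omega> B)"
      using right_charge_tendsto[OF A] twosided_charge_tendsto[OF A] by (blast intro: convergentI)+
  next
    fix \<epsilon> :: real
    assume cauchy: "\<forall>\<epsilon>>0. \<exists>N. \<forall>m\<ge>N. \<forall>n\<ge>N. norm_star \<omega> st tr (A m - A n) < \<epsilon>" and "\<epsilon> > 0"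
    from form_star.lim_uniform[OF A cauchy[unfolded norm_star_def] this(2)]
    obtain N where N: "\<And>j B. j \<ge> N \<Longrightarrow> B \<in> Oall OX \<Longrightarrow>
        cmod (lim (\<lambda>i. form_star \<omega> st tr (A i) B) - form_star \<omega> st tr (A j) B) \<le> \<epsilon> * norm_star \<omega> st tr B"
      unfolding norm_star_def by blast
    show "\<exists>N. \<forall>j\<ge>N. \<forall>B\<in>Oall OX. norm_star \<omega> st tr B > 0 \<longrightarrow>
          cmod (lim (\<lambda>i. form_star \<omega> st tr (A i) B)
                - right_charge \<omega> st (local_seq tr (A j) (u j)) B) / norm_star \<omega> st tr B \<le> \<epsilon>"
      by (intro exI[of _ N] allI ballI impI) (simp add: right N pos_divide_le_eq)
  next
    fix \<epsilon> :: real
    assume cauchy: "\<forall>\<epsilon>>0. \<exists>N. \<forall>m\<ge>N. \<forall>n\<ge>N. norm_hat \<omega> st tr (A m - A n) < \<epsilon>" and "\<epsilon> > 0"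
    from form_hat.lim_uniform[OF A cauchy[unfolded norm_hat_def] this(2)]
    obtain N where N: "\<And>j B. j \<ge> N \<Longrightarrow> B \<in> Oall OX \<Longrightarrow>
        cmod (lim (\<lambda>i. form_hat \<omega> st tr (A i) B) - form_hat \<omega> st tr (A j) B) \<le> \<epsilon> * norm_hat \<omega> st tr B"
      unfolding norm_hat_def by blast
    show "\<exists>N. \<forall>j\<ge>N. \<forall>B\<in>Oall OX. norm_hat \<omega> st tr B > 0 \<longrightarrow>
          cmod (lim (\<lambda>i. form_hat \<omega> st tr (A i) B)
                - twosided_charge \<omega> st (local_seq tr (A j) (u j)) B) / norm_hat \<omega> st tr B \<le> \<epsilon>"
      by (intro exI[of _ N] allI ballI impI) (simp add: twosided N pos_divide_le_eq)
  qed
qed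

end
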